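(* Let $\mathcal{P}=(\mathcal{E},D,c,f_c)$ be a combinatorial sum problem and $E=\{e_1,e_2,e_3\}\subseteq\mathcal{E}$. Then $l'_{\mathcal{P}}(E)=\min\{f_c(D_{+}(E))-c^\ast,\ l'_{\mathcal{P}}(e_1)+l'_{\mathcal{P}}(e_2,e_3),\ l'_{\mathcal{P}}(e_2)+l'_{\mathcal{P}}(e_1,e_3),\ l'_{\mathcal{P}}(e_3)+l'_{\mathcal{P}}(e_1,e_2),\ \tfrac12(l'_{\mathcal{P}}(e_1,e_2)+l'_{\mathcal{P}}(e_1,e_3)+l'_{\mathcal{P}}(e_2,e_3))\}$.
   Context: A combinatorial sum problem (CSP) is a tuple $\mathcal{P}=(\mathcal{E},D,c,f_c)$, where $\mathcal{E}$ is a finite ground set, $D\subseteq 2^{\mathcal{E}}\setminus\{\emptyset\}$ is the set of feasible solutions, $c:\mathcal{E}\to\mathbb{R}$ and $f_c(S)=\sum_{e\in S}c(e)$ for $S\in D$. For $M\subseteq D$, $f_c(M)=\min_{S\in M}f_c(S)$, with $f_c(\emptyset)=\infty$; $c^\ast=f_c(D)$. $D_{+}(A)=\{S\in D: A\subseteq S\}$. For $F=\{f_1,\dots,f_m\}\subseteq\mathcal{E}$ and $\vec\alpha\in\mathbb{R}^m$, $\mathcal{P}_{c_{-\vec\alpha,F}}$ is the CSP with cost of $f_i$ changed to $c(f_i)-\alpha_i$ and other costs unchanged. Single lower tolerance: $l'_{\mathcal{P}}(e)=\max\{\alpha\ge0:$ the optimal value of $\mathcal{P}_{c_{-\alpha,e}}$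 equals $c^\ast\}$. Set lower tolerance: $l'_{\mathcal{P}}(F)=\max\{\alpha\in\mathbb{R}:$ there exists $\vec\alpha$ with all $\alpha_i\ge0$, $\alpha=\sum_i\alpha_i$, such that the optimal value of $\mathcal{P}_{c_{-\vec\alpha,F}}$ equals $c^\ast\}$; we write $l'_{\mathcal{P}}(e_1,e_2)=l'_{\mathcal{P}}(\{e_1,e_2\})$. Tolerances take the value $\infty$ when the set is unbounded. *)

theory Defs
  imports "HOL-Library.Extended_Real"
begin

(* The cost function is total on 'a; its values outside the ground set are irrelevant. *)
record 'a csp =
  ground :: "'a set"
  feasible :: "'a set set"
  cost :: "'a \<Rightarrow> real"

(* An empty set of feasible solutions is allowed; the optimal value is then \<infinity>, and
   differences of minimal costs follow the ereal convention \<infinity> - \<infinity> = \<infinity>. *)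
definition combinatorial_sum_problem :: "'a csp \<Rightarrow> bool" where
  "combinatorial_sum_problem P \<longleftrightarrow> finite (ground P) \<and> feasible P \<subseteq> Pow (ground P) - {{}}"

definition solution_cost :: "'a csp \<Rightarrow> 'a set \<Rightarrow> real" where
  "solution_cost P S = (\<Sum>e\<in>S. cost P e)"

definition min_cost :: "'a csp \<Rightarrow> 'a set set \<Rightarrow> ereal" where
  "min_cost P M = (if M = {} then \<infinity> else ereal (Min (solution_cost P ` M)))"

definition opt_value :: "'a csp \<Rightarrow> ereal" where
  "opt_value P = min_cost P (feasible P)"

definition feasible_containing :: "'a csp \<Rightarrow> 'a set \<Rightarrow> 'a set set" where
  "feasible_containing P A = {S \<in> feasible P. A \<subseteq> S}"

(* The vector of decrements is indexed by the elements of F themselves. *)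
definition decrease_cost :: "'a csp \<Rightarrow> ('a \<Rightarrow> real) \<Rightarrow> 'a set \<Rightarrow> 'a csp" where
  "decrease_cost P \<alpha> F = P\<lparr>cost := (\<lambda>e. if e \<in> F then cost P e - \<alpha> e else cost P e)\<rparr>"

(* Maximum of a set of reals, with value \<infinity> if the set is unbounded. The tolerance sets
   below contain 0, and when bounded they attain their maximum, being given by finitely
   many non-strict linear inequalities. *)
definition max_or_infinity :: "real set \<Rightarrow> ereal" where
  "max_or_infinity A = (if bdd_above A then ereal (GREATEST a. a \<in> A) else \<infinity>)"

definition lower_tolerance :: "'a csp \<Rightarrow> 'a \<Rightarrow> ereal" where
  "lower_tolerance P e =
     max_or_infinity {\<alpha>. 0 \<le> \<alpha> \<and> opt_value (decrease_cost P (\<lambda>_. \<alpha>) {e}) = opt_value P}"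

definition set_lower_tolerance :: "'a csp \<Rightarrow> 'a set \<Rightarrow> ereal" where
  "set_lower_tolerance P F =
     max_or_infinity {a. \<exists>\<alpha>. (\<forall>f\<in>F. 0 \<le> \<alpha> f) \<and> a = (\<Sum>f\<in>F. \<alpha> f) \<and>
                           opt_value (decrease_cost P \<alpha> F) = opt_value P}"

end

(* Only the slacks g(A) = f_c(D_+(A)) - c* of the subsets A of F matter: a nonnegative
   decrement vector \<alpha> on F preserves the optimum iff \<alpha>(A) \<le> g(A) for all A \<subseteq> F. Hence the
   tolerance of F is the value of a linear program, and for |F| \<le> 3 the total t is attainable
   iff it meets the listed bounds. Eliminating the third variable for |F| = 3 leaves intervals
   for x, y and x + y; they are compatible because g is monotone. Infinite slacks are cut off
   at 2 t, which affects none of the bounds on t. *)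
theory Submission
  imports Defs
begin

section \<open>Slacks of sets of elements\<close>

definition slack :: "'a csp \<Rightarrow> 'a set \<Rightarrow> ereal" where
  "slack P A = min_cost P (feasible_containing P A) - opt_value P"

lemma le_min_cost_iff:
  assumes "finite M"
  shows "ereal t \<le> min_cost P M \<longleftrightarrow> (\<forall>S\<in>M. t \<le> solution_cost P S)"
  using assms by (auto simp: min_cost_def)

lemma finite_feasible:
  assumes "combinatorial_sum_problem P"
  shows "finite (feasible P)"
  using assms unfolding combinatorial_sum_problem_def
  by (auto intro: finite_subset[of _ "Pow (ground P)"])

lemma finite_feasible_member:
  assumes "combinatorial_sum_problem P" "S \<in> feasible P"
  shows "finite S"
  using assms unfolding combinatorial_sum_problem_def
  by (auto intro: finite_subset)

text \<open>With a finite optimum \<open>c\<close>, the ereal difference unfolds into real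
  inequalities, one per solution. If no solution contains \<open>A\<close>, the slack is \<infinity>
  and the right side is vacuous.\<close>

lemma le_slack_iff:
  assumes "combinatorial_sum_problem P" "opt_value P = ereal c"
  shows "ereal t \<le> slack P A \<longleftrightarrow> (\<forall>S\<in>feasible P. A \<subseteq> S \<longrightarrow> c + t \<le> solution_cost P S)"
proof -
  have "ereal t \<le> slack P A \<longleftrightarrow> ereal (c + t) \<le> min_cost P (feasible_containing P A)"
    unfolding slack_def assms(2)
    by (cases "min_cost P (feasible_containing P A)") auto
  also have "\<dots> \<longleftrightarrow> (\<forall>S\<in>feasible_containing P A. c + t \<le> solution_cost P S)"
    using finite_feasible[OF assms(1)] by (intro le_min_cost_iff) (simp add: feasible_containing_def)
  finally show ?thesis by (auto simp: feasible_containing_def)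
qed

lemma slack_infeasible: "feasible P = {} \<Longrightarrow> slack P A = \<infinity>"
  by (simp add: slack_def feasible_containing_def min_cost_def opt_value_def)

lemma opt_value_finite:
  assumes "combinatorial_sum_problem P" "feasible P \<noteq> {}"
  obtains c S where "opt_value P = ereal c" "S \<in> feasible P" "solution_cost P S = c"
    "\<And>S. S \<in> feasible P \<Longrightarrow> c \<le> solution_cost P S"
proof -
  let ?c = "Min (solution_cost P ` feasible P)"
  have fin: "finite (solution_cost P ` feasible P)"
    using finite_feasible[OF assms(1)] by simp
  with assms(2) have "?c \<in> solution_cost P ` feasible P" by (intro Min_in) auto
  then obtain S where "S \<in> feasible P" "solution_cost P S = ?c" by auto
  with that[of ?c S] show thesis
    using assms(2) fin by (simp add: opt_value_def min_cost_def)
qed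

lemma slack_nonneg:
  assumes "combinatorial_sum_problem P"
  shows "0 \<le> slack P A"
proof (cases "feasible P = {}")
  case True
  then show ?thesis by (simp add: slack_infeasible)
next
  case False
  from opt_value_finite[OF assms False] obtain c where
    c: "opt_value P = ereal c" "\<And>S. S \<in> feasible P \<Longrightarrow> c \<le> solution_cost P S"
    by metis
  then show ?thesis
    using le_slack_iff[OF assms c(1), of 0 A] by (simp add: zero_ereal_def)
qed

text \<open>Solutions containing \<open>B\<close> also contain \<open>A\<close>, so they form a
  smaller family with a larger minimum. Comparing real lower bounds \<open>t\<close> also covers
  infinite slacks.\<close>

lemma slack_mono:
  assumes "combinatorial_sum_problem P" "A \<subseteq> B"
  shows "slack P A \<le> slack P B"
proof (cases "feasible P = {}")
  case True
  then show ?thesis by (simp add: slack_infeasible)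
next
  case False
  from opt_value_finite[OF assms(1) False] obtain c where c: "opt_value P = ereal c" by metis
  have le: "ereal t \<le> slack P B" if "ereal t \<le> slack P A" for t
    using that assms(2) by (auto simp: le_slack_iff[OF assms(1) c])
  show ?thesis
  proof (cases "slack P A")
    case PInf
    then have "ereal t \<le> slack P B" for t using le by simp
    then have "slack P B = \<infinity>" by (metis ereal_top)
    then show ?thesis by simp
  next
    case (real r)
    then show ?thesis using le[of r] by simp
  qed simp
qed

section \<open>Decrements that preserve the optimum\<close>

lemma solution_cost_decrease:
  assumes "finite S"
  shows "solution_cost (decrease_cost P \<alpha> F) S = solution_cost P S - sum \<alpha> (S \<inter> F)"
proof -
  have "solution_cost (decrease_cost P \<alpha> F) S
      = (\<Sum>e\<in>S. cost P e - (if e \<in> F then \<alpha> e else 0))"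
    unfolding solution_cost_def decrease_cost_def by (auto intro: sum.cong)
  also have "\<dots> = solution_cost P S - sum \<alpha> (S \<inter> F)"
    using assms by (simp add: solution_cost_def sum_subtractf sum.inter_restrict)
  finally show ?thesis .
qed

text \<open>Nonnegative decrements can only lower the optimum, so it is preserved iff no solution
  \<open>S\<close> drops below the old value, and \<open>S\<close> drops by the sum of \<alpha> over
  \<open>S \<inter> F\<close>. Ranging over all \<open>A \<subseteq> F\<close> contained in
  \<open>S\<close> adds no constraint, since nonnegativity makes \<open>S \<inter> F\<close> the
  strictest choice.\<close>

lemma opt_value_decrease_iff:
  assumes P: "combinatorial_sum_problem P" and F: "finite F"
    and nonneg: "\<And>f. f \<in> F \<Longrightarrow> 0 \<le> \<alpha> f"
  shows "opt_value (decrease_cost P \<alpha> F) = opt_value P \<longleftrightarrow>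
    (\<forall>A\<subseteq>F. ereal (sum \<alpha> A) \<le> slack P A)"
proof (cases "feasible P = {}")
  case True
  then show ?thesis
    by (simp add: slack_infeasible opt_value_def min_cost_def decrease_cost_def)
next
  case False
  let ?Q = "decrease_cost P \<alpha> F"
  have feas: "feasible ?Q = feasible P" by (simp add: decrease_cost_def)
  have Q: "combinatorial_sum_problem ?Q"
    using P by (simp add: combinatorial_sum_problem_def decrease_cost_def)
  have cost: "solution_cost ?Q S = solution_cost P S - sum \<alpha> (S \<inter> F)" if "S \<in> feasible P" for S
    using finite_feasible_member[OF P that] by (rule solution_cost_decrease)
  from opt_value_finite[OF P False] obtain c S0 where
    c: "opt_value P = ereal c" and S0: "S0 \<in> feasible P" "solution_cost P S0 = c"
    by metis
  from opt_value_finite[OF Q] False feas obtain d where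
    d: "opt_value ?Q = ereal d" "\<And>S. S \<in> feasible P \<Longrightarrow> d \<le> solution_cost ?Q S"
    by metis
  \<comment> \<open>The old optimal solution \<open>S0\<close> costs at most \<open>c\<close> after
    the decrease.\<close>
  have "d \<le> c"
    using d(2)[OF S0(1)] cost[OF S0(1)] S0(2) sum_nonneg[of "S0 \<inter> F" \<alpha>] nonneg by force
  then have "opt_value ?Q = opt_value P \<longleftrightarrow> ereal c \<le> opt_value ?Q"
    using c d(1) by auto
  also have "\<dots> \<longleftrightarrow> (\<forall>S\<in>feasible P. c + sum \<alpha> (S \<inter> F) \<le> solution_cost P S)"
    unfolding opt_value_def using finite_feasible[OF P]
    by (auto simp: feas le_min_cost_iff cost le_diff_eq)
  also have "\<dots> \<longleftrightarrow> (\<forall>A\<subseteq>F. \<forall>S\<in>feasible P. A \<subseteq> S \<longrightarrow> c + sum \<alpha> A \<le> solution_cost P S)"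
  proof (intro iffI allI impI ballI)
    fix A S
    assume "\<forall>S\<in>feasible P. c + sum \<alpha> (S \<inter> F) \<le> solution_cost P S" "A \<subseteq> F" "S \<in> feasible P" "A \<subseteq> S"
    moreover have "sum \<alpha> A \<le> sum \<alpha> (S \<inter> F)"
      using \<open>A \<subseteq> F\<close> \<open>A \<subseteq> S\<close> F nonneg by (intro sum_mono2) auto
    ultimately show "c + sum \<alpha> A \<le> solution_cost P S" by force
  qed auto
  finally show ?thesis by (simp add: le_slack_iff[OF P c])
qed

section \<open>Tolerances as right ends of intervals\<close>

lemma max_or_infinity_eqI:
  assumes "0 \<le> R" "\<And>t. t \<in> A \<longleftrightarrow> 0 \<le> t \<and> ereal t \<le> R"
  shows "max_or_infinity A = R"
proof (cases R)
  case (real r)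
  then have A: "A = {0..r}" by (intro set_eqI) (simp add: assms(2))
  have "0 \<le> r" using assms(1) real by simp
  then have "(GREATEST a. a \<in> A) = r" by (intro Greatest_equality) (auto simp: A)
  then show ?thesis by (simp add: max_or_infinity_def A real)
next
  case PInf
  then have A: "A = {0..}" by (intro set_eqI) (simp add: assms(2))
  have "\<not> bdd_above A"
  proof
    assume "bdd_above A"
    then obtain M where M: "\<And>x. x \<in> A \<Longrightarrow> x \<le> M" by (auto simp: bdd_above_def)
    \<comment> \<open>\<open>M + 1\<close> exceeds the bound, and the maximum with 0 keeps the
      element in \<open>A\<close>.\<close>
    from M[of "max 0 (M + 1)"] show False by (simp add: A)
  qed
  then show ?thesis by (simp add: max_or_infinity_def PInf)
next
  case MInf
  then show ?thesis using assms(1) by simp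
qed

text \<open>The last two premises say that every admissible vector obeys the bound and that every
  total up to \<open>R\<close> is realised. Asking for all totals, not only the largest, treats
  finite and infinite \<open>R\<close> alike.\<close>

lemma set_lower_tolerance_eqI:
  assumes P: "combinatorial_sum_problem P" and "finite F" "0 \<le> R"
    and "\<And>\<alpha>. (\<And>f. f \<in> F \<Longrightarrow> 0 \<le> \<alpha> f) \<Longrightarrow> (\<And>A. A \<subseteq> F \<Longrightarrow> ereal (sum \<alpha> A) \<le> slack P A) \<Longrightarrow>
      ereal (sum \<alpha> F) \<le> R"
    and "\<And>t. 0 \<le> t \<Longrightarrow> ereal t \<le> R \<Longrightarrow>
      \<exists>\<alpha>. (\<forall>f\<in>F. 0 \<le> \<alpha> f) \<and> t = sum \<alpha> F \<and> (\<forall>A\<subseteq>F. ereal (sum \<alpha> A) \<le> slack P A)"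
  shows "set_lower_tolerance P F = R"
  unfolding set_lower_tolerance_def
proof (rule max_or_infinity_eqI)
  fix t
  \<comment> \<open>Nonnegativity, the first conjunct, is the premise for rewriting the third;
    \<open>conj_cong\<close> makes it available there.\<close>
  have iff: "(\<forall>f\<in>F. 0 \<le> \<alpha> f) \<and> t = sum \<alpha> F \<and> opt_value (decrease_cost P \<alpha> F) = opt_value P \<longleftrightarrow>
      (\<forall>f\<in>F. 0 \<le> \<alpha> f) \<and> t = sum \<alpha> F \<and> (\<forall>A\<subseteq>F. ereal (sum \<alpha> A) \<le> slack P A)" for \<alpha>
    using opt_value_decrease_iff[OF P \<open>finite F\<close>, of \<alpha>] by (simp cong: conj_cong)
  show "t \<in> {a. \<exists>\<alpha>. (\<forall>f\<in>F. 0 \<le> \<alpha> f) \<and> a = sum \<alpha> F \<and>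
          opt_value (decrease_cost P \<alpha> F) = opt_value P} \<longleftrightarrow> 0 \<le> t \<and> ereal t \<le> R"
    unfolding mem_Collect_eq iff
  proof
    assume "\<exists>\<alpha>. (\<forall>f\<in>F. 0 \<le> \<alpha> f) \<and> t = sum \<alpha> F \<and> (\<forall>A\<subseteq>F. ereal (sum \<alpha> A) \<le> slack P A)"
    then obtain \<alpha> where \<alpha>: "\<forall>f\<in>F. 0 \<le> \<alpha> f" "t = sum \<alpha> F" "\<forall>A\<subseteq>F. ereal (sum \<alpha> A) \<le> slack P A"
      by blast
    then show "0 \<le> t \<and> ereal t \<le> R"
      using assms(4)[of \<alpha>] sum_nonneg[of F \<alpha>] by simp
  qed (use assms(5) in simp)
qed fact

lemma lower_tolerance_eq_slack:
  assumes "combinatorial_sum_problem P"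
  shows "lower_tolerance P e = slack P {e}"
  unfolding lower_tolerance_def
proof (rule max_or_infinity_eqI)
  fix t
  show "t \<in> {\<alpha>. 0 \<le> \<alpha> \<and> opt_value (decrease_cost P (\<lambda>_. \<alpha>) {e}) = opt_value P} \<longleftrightarrow>
      0 \<le> t \<and> ereal t \<le> slack P {e}"
    using opt_value_decrease_iff[OF assms, of "{e}" "\<lambda>_. t"] slack_nonneg[OF assms, of "{}"]
    by (auto simp: subset_singleton_iff zero_ereal_def)
qed (rule slack_nonneg[OF assms])

section \<open>Truncating slacks to real numbers\<close>

definition truncate_at :: "real \<Rightarrow> ereal \<Rightarrow> real" where
  "truncate_at K X = real_of_ereal (min X (ereal K))"

lemma
  assumes "0 \<le> X" "0 \<le> K"
  shows truncate_at_nonneg: "0 \<le> truncate_at K X"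
    and truncate_at_le: "ereal (truncate_at K X) \<le> X"
    and truncate_at_upper: "truncate_at K X \<le> K"
  using assms by (cases X; simp add: truncate_at_def min_def)+

lemma truncate_at_mono:
  assumes "0 \<le> X" "X \<le> Y" "0 \<le> K"
  shows "truncate_at K X \<le> truncate_at K Y"
  using assms by (cases X; cases Y; simp add: truncate_at_def min_def)

text \<open>If either summand is cut, the right side is already at least \<open>K\<close>; otherwise
  it is \<open>X + Y\<close>. This carries bounds by sums of slacks over to the truncated
  slacks.\<close>

lemma truncate_at_add_le:
  assumes "0 \<le> X" "0 \<le> Y" "0 \<le> K"
  shows "truncate_at K (X + Y) \<le> truncate_at K X + truncate_at K Y"
  using assms by (cases X; cases Y; simp add: truncate_at_def min_def)

lemma le_truncate_at:
  assumes "ereal t \<le> X" "0 \<le> t" "t \<le> K"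
  shows "t \<le> truncate_at K X"
  using assms by (cases X; simp add: truncate_at_def min_def)

lemma le_truncate_at_add:
  assumes "ereal t \<le> X + Y" "0 \<le> X" "0 \<le> Y" "0 \<le> t" "t \<le> K"
  shows "t \<le> truncate_at K X + truncate_at K Y"
  using le_truncate_at[OF assms(1,4,5)] truncate_at_add_le[of X Y K] assms by linarith

lemma le_truncate_at_add3:
  assumes "ereal t \<le> X + Y + Z" "0 \<le> X" "0 \<le> Y" "0 \<le> Z" "0 \<le> t" "t \<le> K"
  shows "t \<le> truncate_at K X + truncate_at K Y + truncate_at K Z"
  using le_truncate_at_add[OF assms(1) _ assms(4-6)] truncate_at_add_le[of X Y K] assms by fastforce

section \<open>Two and three elements\<close>

lemma ereal_le_half_iff: "ereal t \<le> 1 / 2 * X \<longleftrightarrow> ereal (2 * t) \<le> X"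
proof -
  have "(1 / 2 :: ereal) = ereal (1 / 2)"
    by (simp add: one_ereal_def)
  then show ?thesis by (cases X) auto
qed

lemma subset_doubleton_iff: "A \<subseteq> {a, b} \<longleftrightarrow> A = {} \<or> A = {a} \<or> A = {b} \<or> A = {a, b}"
  by auto

text \<open>The upper bound adds the two singleton constraints. Attainment is greedy:
  \<open>a\<close> takes as much of \<open>t\<close> as its slack allows, and \<open>b\<close> takes
  the rest.\<close>

lemma set_lower_tolerance_pair:
  assumes P: "combinatorial_sum_problem P" and "a \<noteq> b"
  shows "set_lower_tolerance P {a, b} = min (slack P {a} + slack P {b}) (slack P {a, b})"
proof (rule set_lower_tolerance_eqI[OF P])
  note nonneg = slack_nonneg[OF P]
  show "0 \<le> min (slack P {a} + slack P {b}) (slack P {a, b})"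
    by (simp add: nonneg)
  fix \<alpha> :: "'a \<Rightarrow> real"
  assume "\<And>A. A \<subseteq> {a, b} \<Longrightarrow> ereal (sum \<alpha> A) \<le> slack P A"
  from this[of "{a}"] this[of "{b}"] this[of "{a, b}"]
  show "ereal (sum \<alpha> {a, b}) \<le> min (slack P {a} + slack P {b}) (slack P {a, b})"
    using \<open>a \<noteq> b\<close> add_mono[of "ereal (\<alpha> a)" "slack P {a}" "ereal (\<alpha> b)" "slack P {b}"] by simp
next
  note nonneg = slack_nonneg[OF P]
  fix t :: real
  assume t: "0 \<le> t" "ereal t \<le> min (slack P {a} + slack P {b}) (slack P {a, b})"
  define x where "x = truncate_at t (slack P {a})"
  \<comment> \<open>\<open>y\<close> is not the share of \<open>b\<close>; it serves to show that
    the rest \<open>t - x\<close> fits within the slack of \<open>b\<close>.\<close>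
  define y where "y = truncate_at t (slack P {b})"
  have xy: "0 \<le> x" "ereal x \<le> slack P {a}" "0 \<le> y" "ereal y \<le> slack P {b}"
    unfolding x_def y_def using nonneg t(1) by (simp_all add: truncate_at_nonneg truncate_at_le)
  have "x \<le> t"
    unfolding x_def using nonneg t(1) by (rule truncate_at_upper)
  have "t \<le> x + y"
    unfolding x_def y_def using t nonneg by (intro le_truncate_at_add) auto
  then have "ereal (t - x) \<le> slack P {b}"
    using xy(4) by (metis add.commute diff_le_eq ereal_less_eq(3) order_trans)
  then show "\<exists>\<alpha>. (\<forall>f\<in>{a, b}. 0 \<le> \<alpha> f) \<and> t = sum \<alpha> {a, b} \<and>
      (\<forall>A\<subseteq>{a, b}. ereal (sum \<alpha> A) \<le> slack P A)"
    using \<open>a \<noteq> b\<close> xy t nonneg[of "{}"] \<open>x \<le> t\<close>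
    by (intro exI[of _ "\<lambda>e. if e = a then x else t - x"])
       (simp add: subset_doubleton_iff all_conj_distrib imp_conjL zero_ereal_def)
qed simp

text \<open>Substituting \<open>z = t - x - y\<close> turns the constraints on \<open>z\<close>,
  \<open>x + z\<close> and \<open>y + z\<close> into \<open>t - c \<le> x + y \<le> t\<close>,
  \<open>t - q \<le> y\<close> and \<open>t - r \<le> x\<close>. The least possible
  \<open>x + y\<close> is fixed first and then split.\<close>

lemma triple_allocation:
  fixes t a b c p q r :: real
  assumes "0 \<le> t" "0 \<le> a" "0 \<le> b" "0 \<le> c"
    and "a \<le> p" "b \<le> p" "a \<le> q" "c \<le> q" "b \<le> r" "c \<le> r"
    and "t \<le> a + b + c" "t \<le> a + r" "t \<le> b + q" "t \<le> c + p" "2 * t \<le> p + q + r"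
  obtains x y z where "0 \<le> x" "0 \<le> y" "0 \<le> z" "x + y + z = t" "x \<le> a" "y \<le> b" "z \<le> c"
    "x + y \<le> p" "x + z \<le> q" "y + z \<le> r"
proof -
  \<comment> \<open>The least admissible \<open>x\<close> and \<open>y\<close>. If both are
    positive, \<open>u + v \<le> p\<close> is the bound on \<open>2 * t\<close>, and
    \<open>u + v \<le> t\<close> follows from \<open>t \<le> a + r \<le> q + r\<close>.\<close>
  define u v where "u = max 0 (t - r)" and "v = max 0 (t - q)"
  have uv: "0 \<le> u" "t - r \<le> u" "u \<le> a" "0 \<le> v" "t - q \<le> v" "v \<le> b" "u + v \<le> t" "u + v \<le> p"
    unfolding u_def v_def using assms by linarith+
  \<comment> \<open>\<open>s\<close> becomes \<open>x + y\<close>; its second lower bound comes from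
    \<open>z \<le> c\<close>.\<close>
  define s where "s = max (u + v) (t - c)"
  have s: "u + v \<le> s" "t - c \<le> s" "s \<le> t" "s \<le> p" "s \<le> a + b"
    unfolding s_def using assms uv by linarith+
  \<comment> \<open>The largest \<open>x\<close> that leaves at least \<open>v\<close> for
    \<open>y = s - x\<close>. Then \<open>y\<close> is either \<open>v\<close> or
    \<open>s - a\<close>, both at most \<open>b\<close>.\<close>
  define x where "x = min a (s - v)"
  have "u \<le> x" "x \<le> a" "v \<le> s - x" "s - x \<le> b"
    unfolding x_def using uv s by linarith+
  then show thesis
    using uv s by (intro that[of x "s - x" "t - s"]) linarith+
qed

lemma all_subset_tripleton_iff:
  "(\<forall>A\<subseteq>{a, b, c}. Q A) \<longleftrightarrow>
    Q {} \<and> Q {a} \<and> Q {b} \<and> Q {c} \<and> Q {a, b} \<and> Q {a, c} \<and> Q {b, c} \<and> Q {a, b, c}"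
proof -
  have "(\<forall>A\<subseteq>{a, b, c}. Q A) \<longleftrightarrow> (\<forall>A\<in>Pow {a, b, c}. Q A)"
    by blast
  also have "\<dots> \<longleftrightarrow>
    Q {} \<and> Q {a} \<and> Q {b} \<and> Q {c} \<and> Q {a, b} \<and> Q {a, c} \<and> Q {b, c} \<and> Q {a, b, c}"
    unfolding Pow_insert Pow_empty by auto
  finally show ?thesis .
qed

theorem theorem16:
  fixes P :: "'a csp" and e1 e2 e3 :: 'a
  assumes "combinatorial_sum_problem P"
    and "{e1, e2, e3} \<subseteq> ground P"
    and "distinct [e1, e2, e3]"
  shows "set_lower_tolerance P {e1, e2, e3} =
    Min {min_cost P (feasible_containing P {e1, e2, e3}) - opt_value P,
         lower_tolerance P e1 + set_lower_tolerance P {e2, e3},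
         lower_tolerance P e2 + set_lower_tolerance P {e1, e3},
         lower_tolerance P e3 + set_lower_tolerance P {e1, e2},
         1 / 2 * (set_lower_tolerance P {e1, e2} + set_lower_tolerance P {e1, e3}
                  + set_lower_tolerance P {e2, e3})}"
proof -
  note P = assms(1)
  note nonneg = slack_nonneg[OF P]
  have neq: "e1 \<noteq> e2" "e1 \<noteq> e3" "e2 \<noteq> e3" using assms(3) by auto
  define a b c where "a = slack P {e1}" and "b = slack P {e2}" and "c = slack P {e3}"
  define p q r T where "p = slack P {e1, e2}" and "q = slack P {e1, e3}" and "r = slack P {e2, e3}"
    and "T = slack P {e1, e2, e3}"
  note defs = a_def b_def c_def p_def q_def r_def T_def
  have nn: "0 \<le> a" "0 \<le> b" "0 \<le> c" "0 \<le> p" "0 \<le> q" "0 \<le> r" "0 \<le> T"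
    unfolding defs by (rule nonneg)+
  have mono: "a \<le> p" "b \<le> p" "a \<le> q" "c \<le> q" "b \<le> r" "c \<le> r"
    unfolding defs by (auto intro!: slack_mono[OF P])
  \<comment> \<open>The claimed minimum with every tolerance replaced by its formula in
    slacks.\<close>
  let ?R = "min T (min (a + min (b + c) r) (min (b + min (a + c) q) (min (c + min (a + b) p)
    (1 / 2 * (min (a + b) p + min (a + c) q + min (b + c) r)))))"
  have "set_lower_tolerance P {e1, e2, e3} = ?R"
  proof (rule set_lower_tolerance_eqI[OF P])
    show "0 \<le> ?R" using nn by (simp add: ereal_0_le_mult)
  next
    fix \<alpha> :: "'a \<Rightarrow> real"
    assume le: "\<And>A. A \<subseteq> {e1, e2, e3} \<Longrightarrow> ereal (sum \<alpha> A) \<le> slack P A"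
    let ?x = "\<alpha> e1" and ?y = "\<alpha> e2" and ?z = "\<alpha> e3"
    have 1: "ereal ?x \<le> a" "ereal ?y \<le> b" "ereal ?z \<le> c"
      unfolding defs using le[of "{e1}"] le[of "{e2}"] le[of "{e3}"] by simp_all
    have "ereal (?x + ?y) \<le> p" "ereal (?x + ?z) \<le> q" "ereal (?y + ?z) \<le> r"
      unfolding defs using le[of "{e1, e2}"] le[of "{e1, e3}"] le[of "{e2, e3}"] neq by simp_all
    with add_mono[OF 1(1,2)] add_mono[OF 1(1,3)] add_mono[OF 1(2,3)]
    have 2: "ereal (?x + ?y) \<le> min (a + b) p" "ereal (?x + ?z) \<le> min (a + c) q"
      "ereal (?y + ?z) \<le> min (b + c) r"
      by simp_all
    have 3: "ereal (?x + ?y + ?z) \<le> T"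
      unfolding defs using le[of "{e1, e2, e3}"] neq by (simp add: add.assoc)
    \<comment> \<open>Adding the three pair bounds counts every coordinate twice, hence the factor
      1/2.\<close>
    have "ereal (2 * (?x + ?y + ?z)) \<le> min (a + b) p + min (a + c) q + min (b + c) r"
      using add_mono[OF add_mono[OF 2(1,2)] 2(3)] by (simp add: algebra_simps)
    then have "ereal (?x + ?y + ?z) \<le> 1 / 2 * (min (a + b) p + min (a + c) q + min (b + c) r)"
      by (simp only: ereal_le_half_iff)
    with 3 add_mono[OF 1(1) 2(3)] add_mono[OF 1(2) 2(2)] add_mono[OF 1(3) 2(1)]
    show "ereal (sum \<alpha> {e1, e2, e3}) \<le> ?R"
      using neq by (simp add: algebra_simps)
  next
    fix t :: real
    assume t: "0 \<le> t" "ereal t \<le> ?R"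
    \<comment> \<open>The half-sum bound compares \<open>2 * t\<close> with slacks, so it survives a
      cut at \<open>2 * t\<close>; the other bounds survive because
      \<open>t \<le> 2 * t\<close>.\<close>
    let ?f = "truncate_at (2 * t)"
    have R: "ereal t \<le> T" "ereal t \<le> a + (b + c)" "ereal t \<le> a + r" "ereal t \<le> b + q" "ereal t \<le> c + p"
      using t(2) unfolding min.bounded_iff
      by (blast intro: order_trans[OF _ add_left_mono] min.cobounded1 min.cobounded2)+
    have "ereal (2 * t) \<le> min (a + b) p + min (a + c) q + min (b + c) r"
      using t(2) by (simp only: min.bounded_iff ereal_le_half_iff)
    \<comment> \<open>The alternatives inside the minima, such as
      \<open>(a + b) + q + r = (a + r) + (b + q)\<close>, are sums of two bounds in
      \<open>R\<close>; the new information is the bound by \<open>p + q + r\<close>.\<close>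
    also have "\<dots> \<le> p + q + r" by (intro add_mono) auto
    finally have half: "2 * t \<le> ?f p + ?f q + ?f r"
      using t(1) nn by (intro le_truncate_at_add3) auto
    obtain x y z where xyz: "0 \<le> x" "0 \<le> y" "0 \<le> z" "x + y + z = t"
      "x \<le> ?f a" "y \<le> ?f b" "z \<le> ?f c" "x + y \<le> ?f p" "x + z \<le> ?f q" "y + z \<le> ?f r"
    proof (rule triple_allocation[of t "?f a" "?f b" "?f c" "?f p" "?f q" "?f r"])
      show "t \<le> ?f a + ?f b + ?f c"
        using R(2) t(1) nn by (intro le_truncate_at_add3) (auto simp: add.assoc)
    qed (use t(1) R nn mono half in \<open>auto intro!: truncate_at_nonneg truncate_at_mono le_truncate_at_add\<close>)
    \<comment> \<open>Truncated slacks lie below the slacks, so the allocation respects the original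
      constraints.\<close>
    have *: "ereal s \<le> X" if "s \<le> ?f X" "0 \<le> X" for s X
      using that t(1) truncate_at_le[of X "2 * t"] by (meson ereal_less_eq(3) order_trans mult_nonneg_nonneg zero_le_numeral)
    let ?\<alpha> = "\<lambda>e. if e = e1 then x else if e = e2 then y else z"
    have "\<forall>A\<subseteq>{e1, e2, e3}. ereal (sum ?\<alpha> A) \<le> slack P A"
      using neq nonneg[of "{}"] xyz(4) R(1) xyz(5-)[THEN *] nn
      by (simp add: all_subset_tripleton_iff zero_ereal_def defs add.assoc)
    then show "\<exists>\<alpha>. (\<forall>f\<in>{e1, e2, e3}. 0 \<le> \<alpha> f) \<and> t = sum \<alpha> {e1, e2, e3} \<and>
        (\<forall>A\<subseteq>{e1, e2, e3}. ereal (sum \<alpha> A) \<le> slack P A)"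
      using neq xyz(1-4) by (intro exI[of _ ?\<alpha>]) (simp add: add.assoc)
  qed simp
  \<comment> \<open>Gives the \<open>Min\<close> of the statement the nesting of \<open>?R\<close>,
    so that both agree once the tolerances are rewritten as slacks.\<close>
  moreover have "Min {x1, x2, x3, x4, x5} = min x1 (min x2 (min x3 (min x4 x5)))"
    for x1 x2 x3 x4 x5 :: ereal
    by simp
  ultimately show ?thesis
    by (simp only: slack_def[symmetric] lower_tolerance_eq_slack[OF P] defs
        set_lower_tolerance_pair[OF P neq(1)] set_lower_tolerance_pair[OF P neq(2)]
        set_lower_tolerance_pair[OF P neq(3)])
qed

end
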